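(* Let $G$ be a finite Abelian group and let $\mathbb F$ be a field over which $G$ is fully representable. Let $\widehat{G}$ denote the set of all group homomorphisms $G\to\mathbb F^\times$. For any two $k$-element subsets $\mathrm{X}=\{\chi_1,\ldots,\chi_k\}$ and $\Psi=\{\psi_1,\ldots,\psi_k\}$ of $\widehat{G}$ there exist elements $a_1,\ldots,a_k\in G$ such that both $\det(\chi_i(a_j))_{1\le i,j\le k}$ and $\det(\psi_i(a_j))_{1\le i,j\le k}$ are different from zero.
   Context: Let $G$ be a finite Abelian group of exponent $n$. $G$ is called fully representable over a field $\mathbb F$ if the multiplicative group $\mathbb F^\times$ contains an element of order $n$. The characters of $G$ (over $\mathbb F$) are the group homomorphisms $G\to\mathbb F^\times$; they form a group $\widehat{G}$ under pointwise multiplication. *)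

theory Defs
  imports "HOL-Algebra.Multiplicative_Group" "Jordan_Normal_Form.VS_Connect"
begin

(* class_ring is the ring record whose carrier is the whole type; it provides the group
   structure on the nonzero elements of a type-class field, so that the notions hom and ord
   are available for it. *)
abbreviation field_units :: "'f::field monoid" where
  "field_units \<equiv> mult_of class_ring"

definition group_exponent :: "('a, 'b) monoid_scheme \<Rightarrow> nat" where
  "group_exponent G = (LEAST n. 0 < n \<and> (\<forall>x\<in>carrier G. x [^]\<^bsub>G\<^esub> n = \<one>\<^bsub>G\<^esub>))"

(* The second argument only selects the field type 'f.  Note that ord is positive exactly for
   elements of finite order, and the exponent of a finite group is positive. *)
definition fully_representable :: "('a, 'b) monoid_scheme \<Rightarrow> 'f::field itself \<Rightarrow> bool" where
  "fully_representable G F \<longleftrightarrow>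
     (\<exists>z\<in>carrier (field_units :: 'f monoid). group.ord (field_units :: 'f monoid) z = group_exponent G)"

(* hom G H only constrains a function on carrier G.  Requiring extensionality makes each
   homomorphism correspond to exactly one function, so that cardinalities of sets of
   characters are the intended ones. *)
definition characters :: "('a, 'b) monoid_scheme \<Rightarrow> ('a \<Rightarrow> 'f::field) set" where
  "characters G = hom G field_units \<inter> extensional (carrier G)"

end

(* If no tuple a works, then every term of the Cauchy-Binet expansion of the matrix
   M_ij = sum_a w(a) chi_i(a) psi_j(a) vanishes, so det M = 0 for every weight w, also with values
   in F[t].  Distinct characters are linearly independent, so w can be chosen such that M_ij is any
   prescribed function of the product chi_i psi_j; take t^(2^r), where r numbers these products
   injectively.  A product occurs at most once in each row and column, and then a swap argument
   shows that a permutation of maximal exponent is unique, so its term in the Leibniz formula is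
   not cancelled and det M is nonzero in every characteristic. *)

theory Submission
  imports Defs
begin

section \<open>Permutations of extremal weight and determinants of monomials\<close>

text \<open>The cell (\<open>i\<close>, \<open>q i\<close>) dominates every cell of \<open>p\<close>
  at which \<open>p\<close> and \<open>q\<close> disagree. Moving \<open>p\<close> onto this cell by
  one transposition gives up only two cells, one in the same row and one in the same column;
  injectivity makes their exponents strictly smaller, so their two powers of 2 together do not
  exceed the one gained.\<close>

lemma exchange_increases_weight:
  fixes c :: "nat \<Rightarrow> nat \<Rightarrow> nat"
  assumes row: "\<forall>i<k. inj_on (c i) {0..<k}"
    and col: "\<forall>j<k. inj_on (\<lambda>i. c i j) {0..<k}"
    and p: "p permutes {0..<k}" and q: "q permutes {0..<k}"
    and i: "i < k" "p i \<noteq> q i"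
    and top: "\<forall>l<k. p l \<noteq> q l \<longrightarrow> c l (p l) \<le> c i (q i)"
  obtains p' where "p' permutes {0..<k}"
    "(\<Sum>l = 0..<k. 2 ^ c l (p l) :: nat) < (\<Sum>l = 0..<k. 2 ^ c l (p' l))"
proof -
  \<comment> \<open>\<open>l\<close> is the row in which \<open>p\<close> occupies column
    \<open>q i\<close>; exchanging rows \<open>i\<close> and \<open>l\<close> frees that column for
    row \<open>i\<close>.\<close>
  define l where "l = inv_into UNIV p (q i)"
  have pl: "p l = q i"
    unfolding l_def by (rule permutes_inverses(1)[OF p])
  have lt: "p m < k" "q m < k" if "m < k" for m
    using permutes_in_image[OF p, of m] permutes_in_image[OF q, of m] that by auto
  have l: "l < k"
    using permutes_in_image[OF p, of l] pl lt i(1) by auto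
  have "l \<noteq> i" using pl i by auto
  then have "q l \<noteq> p l" using pl permutes_inj[OF q] by (auto dest: injD)
  have "c l (p l) \<noteq> c i (q i)"
    using inj_onD[OF col[rule_format, OF lt(2)[OF i(1)]], of l i] i(1) l \<open>l \<noteq> i\<close> pl by auto
  then have 1: "c l (p l) < c i (q i)"
    using top l \<open>q l \<noteq> p l\<close> by fastforce
  have "c i (p i) \<noteq> c i (q i)"
    using inj_onD[OF row[rule_format, OF i(1)], of "p i" "q i"] i lt by auto
  then have 2: "c i (p i) < c i (q i)"
    using top i by fastforce
  define p' where "p' = p \<circ> transpose i l"
  have "p' permutes {0..<k}"
    unfolding p'_def using p i(1) l
    by (intro permutes_compose permutes_swap_id) auto
  moreover have "(\<Sum>m = 0..<k. 2 ^ c m (p m) :: nat) < (\<Sum>m = 0..<k. 2 ^ c m (p' m))"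
  proof -
    have split: "(\<Sum>m = 0..<k. f m) = f i + f l + (\<Sum>m \<in> {0..<k} - {i, l}. f m)" for f :: "nat \<Rightarrow> nat"
    proof -
      have "(\<Sum>m = 0..<k. f m) = (\<Sum>m \<in> {0..<k} - {i, l}. f m) + (\<Sum>m \<in> {i, l}. f m)"
        by (rule sum.subset_diff) (use i(1) l in auto)
      then show ?thesis using \<open>l \<noteq> i\<close> by simp
    qed
    have rest: "(\<Sum>m \<in> {0..<k} - {i, l}. 2 ^ c m (p' m)) = (\<Sum>m \<in> {0..<k} - {i, l}. 2 ^ c m (p m) :: nat)"
      by (rule sum.cong) (auto simp: p'_def transpose_def)
    \<comment> \<open>Both lost powers are at most \<open>2 ^ e\<close>, so they sum to at most
      \<open>2 ^ Suc e\<close>. Strictness comes from the second new term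
      \<open>2 ^ c l (p i)\<close>, of which only positivity is known.\<close>
    obtain e where e: "c i (q i) = Suc e" using 1 by (cases "c i (q i)") auto
    have "(2::nat) ^ c i (p i) \<le> 2 ^ e" "(2::nat) ^ c l (p l) \<le> 2 ^ e" "(0::nat) < 2 ^ c l (p i)"
      using 1 2 e by (auto intro: power_increasing)
    then have "(2::nat) ^ c i (p i) + 2 ^ c l (p l) < 2 ^ c i (q i) + 2 ^ c l (p i)"
      unfolding e power_Suc by linarith
    then show ?thesis
      unfolding split rest by (simp add: p'_def pl)
  qed
  ultimately show thesis by (rule that)
qed

text \<open>A maximizer works. If another permutation ties with it, consider the largest exponent
  among the cells where the two disagree: whichever of the two owns it, the other can be improved by
  an exchange, against the maximality of the common weight.\<close>

lemma unique_weight_permutation: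
  fixes c :: "nat \<Rightarrow> nat \<Rightarrow> nat"
  assumes row: "\<forall>i<k. inj_on (c i) {0..<k}"
    and col: "\<forall>j<k. inj_on (\<lambda>i. c i j) {0..<k}"
  obtains p where "p permutes {0..<k}"
    "\<And>q. q permutes {0..<k} \<Longrightarrow> (\<Sum>l = 0..<k. 2 ^ c l (q l) :: nat) = (\<Sum>l = 0..<k. 2 ^ c l (p l)) \<Longrightarrow> q = p"
proof -
  define E where "E p = (\<Sum>l = 0..<k. 2 ^ c l (p l) :: nat)" for p
  define P where "P = {p. p permutes {0..<k}}"
  have fin: "finite P" unfolding P_def by (rule finite_permutations) simp
  have ne: "P \<noteq> {}" unfolding P_def using permutes_id by blast
  obtain p where p: "p \<in> P" and max: "\<And>q. q \<in> P \<Longrightarrow> E q \<le> E p"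
    using Max_in[of "E ` P"] Max_ge[of "E ` P"] fin ne by fastforce
  have "q = p" if q: "q \<in> P" and eq: "E q = E p" for q
  proof (rule ccontr)
    assume "q \<noteq> p"
    have pp: "p permutes {0..<k}" and qq: "q permutes {0..<k}" using p q by (auto simp: P_def)
    define D where "D = {i. i < k \<and> p i \<noteq> q i}"
    have finD: "finite D" unfolding D_def by simp
    have "D \<noteq> {}"
      using \<open>q \<noteq> p\<close> permutes_not_in[OF pp] permutes_not_in[OF qq] unfolding D_def
      by (auto simp: fun_eq_iff) metis
    \<comment> \<open>Exponents of both permutations are collected, so that the maximum supplies the
      bound for an exchange in either direction.\<close>
    define V where "V = (\<lambda>i. c i (p i)) ` D \<union> (\<lambda>i. c i (q i)) ` D"
    have V: "Max V \<in> V" "\<And>v. v \<in> V \<Longrightarrow> v \<le> Max V"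
      using finD \<open>D \<noteq> {}\<close> Max_in[of V] Max_ge[of V] unfolding V_def by simp_all
    then consider i where "i \<in> D" "Max V = c i (q i)" | i where "i \<in> D" "Max V = c i (p i)"
      unfolding V_def by auto
    then show False
    proof cases
      case 1
      from 1 have i: "i < k" "p i \<noteq> q i" by (auto simp: D_def)
      have "\<forall>l<k. p l \<noteq> q l \<longrightarrow> c l (p l) \<le> c i (q i)"
      proof (intro allI impI)
        fix l assume "l < k" "p l \<noteq> q l"
        then have "c l (p l) \<in> V" by (auto simp: V_def D_def)
        from V(2)[OF this] 1(2) show "c l (p l) \<le> c i (q i)" by simp
      qed
      from exchange_increases_weight[OF row col pp qq i this]
      obtain p' where "p' permutes {0..<k}" "E p < E p'" unfolding E_def by blast
      with max[of p'] show False by (simp add: P_def)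
    next
      case 2
      from 2 have i: "i < k" "q i \<noteq> p i" by (auto simp: D_def)
      have "\<forall>l<k. q l \<noteq> p l \<longrightarrow> c l (q l) \<le> c i (p i)"
      proof (intro allI impI)
        fix l assume "l < k" "q l \<noteq> p l"
        then have "c l (q l) \<in> V" by (auto simp: V_def D_def)
        from V(2)[OF this] 2(2) show "c l (q l) \<le> c i (p i)" by simp
      qed
      from exchange_increases_weight[OF row col qq pp i this]
      obtain p' where "p' permutes {0..<k}" "E q < E p'" unfolding E_def by blast
      with max[of p'] eq show False by (simp add: P_def)
    qed
  qed
  with p show thesis
    unfolding E_def P_def by (intro that) auto
qed

text \<open>At an exponent attained by only one permutation, the Leibniz expansion has a single
  contribution, namely its sign. This is 1 or -1, hence nonzero even in characteristic 2.\<close>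

lemma det_distinct_monomials_nonzero:
  fixes c :: "nat \<Rightarrow> nat \<Rightarrow> nat"
  assumes row: "\<forall>i<k. inj_on (c i) {0..<k}"
    and col: "\<forall>j<k. inj_on (\<lambda>i. c i j) {0..<k}"
  shows "det (mat k k (\<lambda>(i, j). monom (1 :: 'f::field) (2 ^ c i j))) \<noteq> 0"
proof -
  from unique_weight_permutation[OF row col]
  obtain p where p: "p permutes {0..<k}" and uniq:
    "\<And>q. q permutes {0..<k} \<Longrightarrow> (\<Sum>l = 0..<k. 2 ^ c l (q l) :: nat) = (\<Sum>l = 0..<k. 2 ^ c l (p l)) \<Longrightarrow> q = p"
    by blast
  define E where "E p = (\<Sum>l = 0..<k. 2 ^ c l (p l) :: nat)" for p
  have prod_monom: "(\<Prod>i\<in>I. monom (1::'f) (e i)) = monom 1 (\<Sum>i\<in>I. e i)" for I :: "nat set" and e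
    by (induction I rule: infinite_finite_induct) (auto simp: mult_monom)
  have lt: "q i < k" if "q permutes {0..<k}" "i < k" for q i
    using permutes_in_image[OF that(1), of i] that(2) by auto
  have "det (mat k k (\<lambda>(i, j). monom (1 :: 'f) (2 ^ c i j)))
      = (\<Sum>q | q permutes {0..<k}. signof q * monom (1 :: 'f) (E q))"
    by (subst det_def'[of _ k]) (auto simp: E_def lt simp flip: prod_monom intro!: sum.cong prod.cong)
  also have "coeff \<dots> (E p) = (\<Sum>q | q permutes {0..<k}. if q = p then signof p else 0)"
    unfolding coeff_sum
    by (rule sum.cong) (use uniq in \<open>auto simp: E_def sign_def\<close>)
  also have "\<dots> = signof p"
    using p by (simp add: finite_permutations)
  finally show ?thesis by (auto simp: sign_def split: if_splits)
qed

section \<open>A weighted Cauchy-Binet expansion\<close>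

text \<open>Expand over all maps from the indices to \<open>S\<close> and group them by image. Each
  group either consists of zeros or sums to a product of weights times one minor of \<open>A\<close>
  times one minor of \<open>B\<close>. Grouping by image spares an ordering of \<open>S\<close> and
  a division by \<open>k!\<close>, which may be zero in \<open>'r\<close>.\<close>

lemma det_sum_product_eq_0:
  fixes A B :: "nat \<Rightarrow> 'a \<Rightarrow> 'r::idom"
  assumes S: "finite S"
    and zero: "\<And>f. f \<in> {0..<k} \<rightarrow> S \<Longrightarrow>
      det (mat k k (\<lambda>(i, j). A i (f j))) = 0 \<or> det (mat k k (\<lambda>(i, j). B i (f j))) = 0"
  shows "det (mat k k (\<lambda>(i, j). \<Sum>a\<in>S. w a * A i a * B j a)) = 0"
proof -
  let ?F = "{0..<k} \<rightarrow>\<^sub>E S"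
  let ?P = "{p. p permutes {0..<k}}"
  define DA where "DA f = det (mat k k (\<lambda>(i, j). A i (f j)))" for f
  define DB where "DB f = det (mat k k (\<lambda>(i, j). B i (f j)))" for f
  have lt: "q i < k" if "q permutes {0..<k}" "i < k" for q i
    using permutes_in_image[OF that(1), of i] that(2) by auto
  have DA: "DA f = (\<Sum>p\<in>?P. signof p * (\<Prod>i=0..<k. A i (f (p i))))" for f
    unfolding DA_def by (subst det_def'[of _ k]) (auto simp: lt intro!: sum.cong prod.cong)
  \<comment> \<open>With \<open>f\<close> indexing rows, the facts on equal and permuted rows
    apply.\<close>
  have DB_rows: "DB f = det (mat k k (\<lambda>(i, j). B j (f i)))" for f
  proof -
    have "DB f = det (transpose_mat (mat k k (\<lambda>(i, j). B i (f j))))"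
      unfolding DB_def by (rule det_transpose[symmetric, of _ k]) simp
    also have "transpose_mat (mat k k (\<lambda>(i, j). B i (f j))) = mat k k (\<lambda>(i, j). B j (f i))"
      by (rule eq_matI) auto
    finally show ?thesis .
  qed
  have DB: "DB f = (\<Sum>p\<in>?P. signof p * (\<Prod>i=0..<k. B (p i) (f i)))" for f
    unfolding DB_rows by (subst det_def'[of _ k]) (auto simp: lt intro!: sum.cong prod.cong)
  \<comment> \<open>The share of \<open>f\<close> in the expansion: the sum over permutations is
    absorbed into \<open>DB f\<close>, while \<open>A\<close> contributes only its diagonal product
    so far.\<close>
  define g where "g f = (\<Prod>i=0..<k. w (f i)) * (\<Prod>i=0..<k. A i (f i)) * DB f" for f
  have "det (mat k k (\<lambda>(i, j). \<Sum>a\<in>S. w a * A i a * B j a))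
      = (\<Sum>p\<in>?P. signof p * (\<Prod>i=0..<k. \<Sum>a\<in>S. w a * A i a * B (p i) a))"
    by (subst det_def'[of _ k]) (auto simp: lt intro!: sum.cong prod.cong)
  also have "\<dots> = (\<Sum>p\<in>?P. \<Sum>f\<in>?F. signof p * (\<Prod>i=0..<k. w (f i) * A i (f i) * B (p i) (f i)))"
    by (subst prod_sum_PiE) (auto simp: S sum_distrib_left)
  also have "\<dots> = (\<Sum>f\<in>?F. g f)"
    unfolding g_def DB
    by (subst sum.swap) (auto simp: prod.distrib sum_distrib_left mult_ac intro!: sum.cong)
  also have "\<dots> = (\<Sum>T\<in>(\<lambda>f. f ` {0..<k}) ` ?F. \<Sum>f\<in>{f\<in>?F. f ` {0..<k} = T}. g f)"
    by (rule sum.image_gen) (simp add: S finite_PiE)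
  also have "\<dots> = 0"
  proof (rule sum.neutral, rule ballI)
    fix T assume "T \<in> (\<lambda>f. f ` {0..<k}) ` ?F"
    then obtain f where f: "f \<in> ?F" and T: "T = f ` {0..<k}" by auto
    \<comment> \<open>A group without a nonzero \<open>DB\<close> vanishes termwise; otherwise any
      \<open>f0\<close> with \<open>DB f0\<close> nonzero serves as reference map.\<close>
    show "(\<Sum>f\<in>{f\<in>?F. f ` {0..<k} = T}. g f) = 0"
    proof (cases "\<exists>f0\<in>?F. f0 ` {0..<k} = T \<and> DB f0 \<noteq> 0")
      case False
      then show ?thesis by (intro sum.neutral) (auto simp: g_def)
    next
      case True
      then obtain f0 where f0: "f0 \<in> ?F" and T: "T = f0 ` {0..<k}" and nz: "DB f0 \<noteq> 0" by auto
      have "DA f0 = 0"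
        using zero[of f0] f0 nz unfolding DA_def DB_def by auto
      \<comment> \<open>A repeated value would give two equal rows.\<close>
      have inj: "inj_on f0 {0..<k}"
      proof (rule inj_onI, rule ccontr)
        fix i j assume ij: "i \<in> {0..<k}" "j \<in> {0..<k}" "f0 i = f0 j" "i \<noteq> j"
        have "DB f0 = 0"
          unfolding DB_rows by (rule det_identical_rows[of _ k i j]) (use ij in \<open>auto simp: row_def\<close>)
        with nz show False by simp
      qed
      \<comment> \<open>Since \<open>f0\<close> is injective, the maps with image \<open>T\<close>
        are exactly its rearrangements; \<open>restrict\<close> keeps them in the extensional
        function space.\<close>
      define h where "h p = restrict (f0 \<circ> p) {0..<k}" for p
      have "bij_betw h ?P {f\<in>?F. f ` {0..<k} = T}"
      proof (rule bij_betwI')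
        fix p q assume "p \<in> ?P" "q \<in> ?P"
        then have p: "p permutes {0..<k}" and q: "q permutes {0..<k}" by auto
        show "(h p = h q) = (p = q)"
        proof
          assume eq: "h p = h q"
          show "p = q"
          proof
            fix i show "p i = q i"
            proof (cases "i < k")
              case True
              then have "f0 (p i) = f0 (q i)" using fun_cong[OF eq, of i] by (simp add: h_def)
              then show ?thesis using inj_onD[OF inj] lt[OF p True] lt[OF q True] by simp
            qed (use permutes_not_in[OF p] permutes_not_in[OF q] in simp)
          qed
        qed simp
      next
        fix p assume "p \<in> ?P"
        then have p: "p permutes {0..<k}" by auto
        have "h p ` {0..<k} = f0 ` p ` {0..<k}" by (auto simp: h_def)
        then show "h p \<in> {f\<in>?F. f ` {0..<k} = T}"
          using f0 T permutes_image[OF p] lt[OF p] by (auto simp: h_def)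
      next
        fix f assume "f \<in> {f\<in>?F. f ` {0..<k} = T}"
        then have f: "f \<in> ?F" "f ` {0..<k} = T" by auto
        \<comment> \<open>The identity outside the index range, as \<open>permutes\<close>
          demands.\<close>
        define p where "p i = (if i \<in> {0..<k} then inv_into {0..<k} f0 (f i) else i)" for i
        have f0p: "f0 (p i) = f i" if "i < k" for i
        proof -
          have "f i \<in> f ` {0..<k}" using that by simp
          then have "f i \<in> f0 ` {0..<k}" unfolding f(2) T .
          then show ?thesis using that by (simp add: p_def f_inv_into_f)
        qed
        \<comment> \<open>\<open>T\<close> has \<open>k\<close> elements, so a map from
          \<open>k\<close> indices onto it is injective.\<close>
        have "card (f ` {0..<k}) = card {0..<k}"
          using f T card_image[OF inj] by simp
        then have injf: "inj_on f {0..<k}" by (intro eq_card_imp_inj_on) auto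
        have "inj_on p {0..<k}"
          by (rule inj_onI) (metis atLeastLessThan_iff f0p inj_onD injf)
        moreover have "p ` {0..<k} \<subseteq> {0..<k}"
        proof safe
          fix i assume "i \<in> {0..<k}"
          then have "f i \<in> f0 ` {0..<k}" using f T by auto
          from inv_into_into[OF this] \<open>i \<in> {0..<k}\<close> show "p i \<in> {0..<k}" by (simp add: p_def)
        qed
        ultimately have "bij_betw p {0..<k} {0..<k}"
          by (simp add: bij_betw_def endo_inj_surj)
        then have "p permutes {0..<k}"
          by (rule bij_imp_permutes) (auto simp: p_def)
        moreover have "f = h p"
          using f by (auto simp: h_def f0p fun_eq_iff PiE_def extensional_def)
        ultimately show "\<exists>p\<in>?P. f = h p" by auto
      qed
      then have "(\<Sum>f\<in>{f\<in>?F. f ` {0..<k} = T}. g f) = (\<Sum>p\<in>?P. g (h p))"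
        by (rule sum.reindex_bij_betw[symmetric])
      \<comment> \<open>Rearranging leaves the product of weights unchanged and multiplies
        \<open>DB\<close> by the sign, which turns the diagonal products of \<open>A\<close> into
        the Leibniz formula for \<open>DA f0\<close>.\<close>
      also have "\<dots> = (\<Sum>p\<in>?P. (\<Prod>i=0..<k. w (f0 i)) * DB f0 * (signof p * (\<Prod>i=0..<k. A i (f0 (p i)))))"
      proof (rule sum.cong[OF refl])
        fix p assume "p \<in> ?P"
        then have p: "p permutes {0..<k}" by simp
        have "DB (h p) = det (mat k k (\<lambda>(i, j). mat k k (\<lambda>(i, j). B j (f0 i)) $$ (p i, j)))"
          unfolding DB_rows by (rule arg_cong[of _ _ det], rule eq_matI) (auto simp: h_def lt[OF p])
        also have "\<dots> = signof p * DB f0"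
          unfolding DB_rows by (rule det_permute_rows[OF _ p]) simp
        finally have "DB (h p) = signof p * DB f0" .
        moreover have "(\<Prod>i=0..<k. w (h p i)) = (\<Prod>i=0..<k. w (f0 i))"
          using prod.permute[OF p, of "\<lambda>i. w (f0 i)"] by (simp add: h_def o_def)
        moreover have "(\<Prod>i=0..<k. A i (h p i)) = (\<Prod>i=0..<k. A i (f0 (p i)))"
          by (simp add: h_def)
        ultimately show "g (h p) = (\<Prod>i=0..<k. w (f0 i)) * DB f0 * (signof p * (\<Prod>i=0..<k. A i (f0 (p i))))"
          by (simp add: g_def mult_ac)
      qed
      also have "\<dots> = (\<Prod>i=0..<k. w (f0 i)) * DB f0 * DA f0"
        unfolding DA by (simp add: sum_distrib_left)
      finally show ?thesis using \<open>DA f0 = 0\<close> by simp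
    qed
  qed
  finally show ?thesis .
qed

section \<open>Characters: independence and interpolation\<close>

lemma carrier_field_units [simp]: "carrier (field_units :: 'f::field monoid) = UNIV - {0}"
  by (auto simp: mult_of_def class_ring_simps)

lemma mult_field_units [simp]: "x \<otimes>\<^bsub>field_units :: 'f::field monoid\<^esub> y = x * y"
  by (auto simp: mult_of_def class_ring_simps)

lemma characters_mult:
  assumes "\<chi> \<in> characters G" "a \<in> carrier G" "b \<in> carrier G"
  shows "\<chi> (a \<otimes>\<^bsub>G\<^esub> b) = \<chi> a * \<chi> b"
  using assms by (auto simp: characters_def hom_def)

lemma characters_nonzero:
  assumes "\<chi> \<in> characters G" "a \<in> carrier G"
  shows "\<chi> a \<noteq> 0"
  using assms by (auto simp: characters_def hom_def Pi_def)

lemma characters_eqI: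
  assumes "\<chi> \<in> characters G" "\<psi> \<in> characters G" "\<And>a. a \<in> carrier G \<Longrightarrow> \<chi> a = \<psi> a"
  shows "\<chi> = \<psi>"
  using assms by (auto simp: characters_def intro: extensionalityI)

lemma characters_product:
  assumes "monoid G" "\<chi> \<in> characters G" "\<psi> \<in> characters G"
  shows "(\<lambda>a\<in>carrier G. \<chi> a * \<psi> a) \<in> characters G"
  using assms characters_nonzero[of \<chi> G] characters_nonzero[of \<psi> G]
  by (auto simp: characters_def hom_def monoid.m_closed)

text \<open>Dedekind's independence of characters in dual form, by induction on \<open>T\<close>. A
  weight \<open>w\<close> acts as a functional on characters, and translating \<open>w\<close> by
  \<open>b\<close> multiplies its value at \<open>\<phi>\<close> by \<open>\<phi> b\<close>. A
  combination of \<open>w\<close> and a translate can therefore kill one more character while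
  keeping the value at \<open>\<theta>\<close>.\<close>

lemma characters_separated:
  fixes \<theta> :: "'a \<Rightarrow> 'f::field"
  assumes G: "group G" and finG: "finite (carrier G)" and "finite T"
    and T: "T \<subseteq> characters G" and \<theta>: "\<theta> \<in> characters G" "\<theta> \<notin> T"
  shows "\<exists>w. (\<Sum>a\<in>carrier G. w a * \<theta> a) = 1 \<and> (\<forall>\<chi>\<in>T. (\<Sum>a\<in>carrier G. w a * \<chi> a) = 0)"
  using \<open>finite T\<close> T \<theta>(2)
proof (induction T)
  interpret G: group G by (rule G)
  case empty
  \<comment> \<open>All weight sits at the identity: evaluation there, normalised at
    \<open>\<theta>\<close>.\<close>
  have "\<theta> \<one>\<^bsub>G\<^esub> \<noteq> 0" using \<theta>(1) by (rule characters_nonzero) simp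
  then have "(\<Sum>a\<in>carrier G. (if a = \<one>\<^bsub>G\<^esub> then inverse (\<theta> a) else 0) * \<theta> a) = 1"
    using finG by (subst sum.mono_neutral_right[of _ "{\<one>\<^bsub>G\<^esub>}"]) auto
  then show ?case by (intro exI[of _ "\<lambda>a. if a = \<one>\<^bsub>G\<^esub> then inverse (\<theta> a) else 0"]) simp
next
  interpret G: group G by (rule G)
  case (insert \<chi> T)
  then obtain w where w1: "(\<Sum>a\<in>carrier G. w a * \<theta> a) = 1"
    and w0: "\<And>\<phi>. \<phi> \<in> T \<Longrightarrow> (\<Sum>a\<in>carrier G. w a * \<phi> a) = 0" by auto
  obtain b where b: "b \<in> carrier G" "\<chi> b \<noteq> \<theta> b"
    using insert.prems \<theta>(1) characters_eqI[of \<chi> G \<theta>] by auto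
  \<comment> \<open>This multiplies the value at \<open>\<phi>\<close> by
    \<open>(\<phi> b - \<chi> b) / (\<theta> b - \<chi> b)\<close>, which is 0 at
    \<open>\<chi>\<close> and 1 at \<open>\<theta>\<close>; zeros on \<open>T\<close>
    survive.\<close>
  define v where "v a = (w (inv\<^bsub>G\<^esub> b \<otimes>\<^bsub>G\<^esub> a) - \<chi> b * w a) / (\<theta> b - \<chi> b)" for a
  have v: "(\<Sum>a\<in>carrier G. v a * \<phi> a) = (\<phi> b - \<chi> b) * (\<Sum>a\<in>carrier G. w a * \<phi> a) / (\<theta> b - \<chi> b)"
    if \<phi>: "\<phi> \<in> characters G" for \<phi>
  proof -
    have "bij_betw (\<lambda>a. b \<otimes>\<^bsub>G\<^esub> a) (carrier G) (carrier G)"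
      by (rule bij_betw_byWitness[of _ "\<lambda>a. inv\<^bsub>G\<^esub> b \<otimes>\<^bsub>G\<^esub> a"])
        (use b in \<open>auto simp flip: G.m_assoc\<close>)
    then have "(\<Sum>a\<in>carrier G. w (inv\<^bsub>G\<^esub> b \<otimes>\<^bsub>G\<^esub> a) * \<phi> a)
        = (\<Sum>a\<in>carrier G. w (inv\<^bsub>G\<^esub> b \<otimes>\<^bsub>G\<^esub> (b \<otimes>\<^bsub>G\<^esub> a)) * \<phi> (b \<otimes>\<^bsub>G\<^esub> a))"
      by (rule sum.reindex_bij_betw[symmetric])
    also have "\<dots> = \<phi> b * (\<Sum>a\<in>carrier G. w a * \<phi> a)"
      using b by (auto simp: sum_distrib_left characters_mult[OF \<phi>] simp flip: G.m_assoc intro!: sum.cong)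
    finally have shift: "(\<Sum>a\<in>carrier G. w (inv\<^bsub>G\<^esub> b \<otimes>\<^bsub>G\<^esub> a) * \<phi> a)
        = \<phi> b * (\<Sum>a\<in>carrier G. w a * \<phi> a)" .
    have "(\<Sum>a\<in>carrier G. v a * \<phi> a)
        = (\<Sum>a\<in>carrier G. (w (inv\<^bsub>G\<^esub> b \<otimes>\<^bsub>G\<^esub> a) * \<phi> a - \<chi> b * (w a * \<phi> a)) / (\<theta> b - \<chi> b))"
      by (simp add: v_def left_diff_distrib mult.assoc)
    also have "\<dots> = (\<phi> b - \<chi> b) * (\<Sum>a\<in>carrier G. w a * \<phi> a) / (\<theta> b - \<chi> b)"
      by (simp only: sum_divide_distrib[symmetric] sum_subtractf shift sum_distrib_left[symmetric] left_diff_distrib)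
    finally show ?thesis .
  qed
  show ?case
  proof (intro exI[of _ v] conjI ballI)
    show "(\<Sum>a\<in>carrier G. v a * \<theta> a) = 1" using v[OF \<theta>(1)] w1 b by simp
  next
    fix \<phi> assume "\<phi> \<in> insert \<chi> T"
    then show "(\<Sum>a\<in>carrier G. v a * \<phi> a) = 0"
      using v[of \<phi>] w0[of \<phi>] insert.prems by auto
  qed
qed

text \<open>Superpose the dual weights of the members of \<open>T\<close> with coefficients
  \<open>e\<close>. Weights are polynomials and character values are embedded as constants, so that
  monomials of different degrees can be prescribed.\<close>

lemma characters_interpolation:
  fixes T :: "('a \<Rightarrow> 'f::field) set" and e :: "('a \<Rightarrow> 'f) \<Rightarrow> 'f poly"
  assumes "group G" "finite (carrier G)" "finite T" "T \<subseteq> characters G"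
  obtains w where "\<And>\<chi>. \<chi> \<in> T \<Longrightarrow> (\<Sum>a\<in>carrier G. w a * [:\<chi> a:]) = e \<chi>"
proof -
  have "\<forall>\<theta>\<in>T. \<exists>w. \<forall>\<chi>\<in>T. (\<Sum>a\<in>carrier G. w a * \<chi> a) = (if \<chi> = \<theta> then 1 else 0)"
  proof
    fix \<theta> assume "\<theta> \<in> T"
    then show "\<exists>w. \<forall>\<chi>\<in>T. (\<Sum>a\<in>carrier G. w a * \<chi> a) = (if \<chi> = \<theta> then 1 else 0)"
      using characters_separated[of G "T - {\<theta>}" \<theta>] assms by fastforce
  qed
  from bchoice[OF this] obtain u where u: "\<And>\<theta> \<chi>. \<theta> \<in> T \<Longrightarrow> \<chi> \<in> T \<Longrightarrow>
      (\<Sum>a\<in>carrier G. u \<theta> a * \<chi> a) = (if \<chi> = \<theta> then 1 else 0)"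
    by blast
  have const: "(\<Sum>a\<in>A. [:f a:]) = [:\<Sum>a\<in>A. f a:]" for f :: "'a \<Rightarrow> 'f" and A
    by (induction A rule: infinite_finite_induct) auto
  define w where "w a = (\<Sum>\<theta>\<in>T. [:u \<theta> a:] * e \<theta>)" for a
  have "(\<Sum>a\<in>carrier G. w a * [:\<chi> a:]) = e \<chi>" if "\<chi> \<in> T" for \<chi>
  proof -
    have "(\<Sum>a\<in>carrier G. w a * [:\<chi> a:]) = (\<Sum>\<theta>\<in>T. e \<theta> * (\<Sum>a\<in>carrier G. [:u \<theta> a * \<chi> a:]))"
      unfolding w_def sum_distrib_right sum_distrib_left
      by (subst sum.swap) (simp add: mult_ac)
    also have "\<dots> = (\<Sum>\<theta>\<in>T. if \<theta> = \<chi> then e \<chi> else 0)"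
      by (rule sum.cong) (use that in \<open>auto simp: const u\<close>)
    finally show ?thesis using that \<open>finite T\<close> by simp
  qed
  then show thesis by (rule that)
qed

section \<open>Passage to polynomials and the contradiction\<close>

lemma det_const_poly_eq_0:
  assumes "det (mat k k (\<lambda>(i, j). f i j)) = (0 :: 'f::field)"
  shows "det (mat k k (\<lambda>(i, j). [:f i j:])) = 0"
proof -
  interpret comm_ring_hom "\<lambda>c::'f. [:c:]"
    by unfold_locales (auto simp: one_pCons)
  have "mat k k (\<lambda>(i, j). [:f i j:]) = map_mat (\<lambda>c. [:c:]) (mat k k (\<lambda>(i, j). f i j))"
    by (rule eq_matI) auto
  then show ?thesis using assms by (simp add: hom_det)
qed

theorem theorem2:
  fixes G :: "('a, 'b) monoid_scheme"
    and X Psi :: "('a \<Rightarrow> 'f::field) set"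
    and chi psi :: "nat \<Rightarrow> 'a \<Rightarrow> 'f"
    and k :: nat
  assumes "comm_group G"
    and "finite (carrier G)"
    and "fully_representable G TYPE('f)"
    and "X \<subseteq> characters G"
    and "Psi \<subseteq> characters G"
    and "bij_betw chi {0..<k} X"
    and "bij_betw psi {0..<k} Psi"
  shows "\<exists>a. (\<forall>j<k. a j \<in> carrier G) \<and>
           det (mat k k (\<lambda>(i, j). chi i (a j))) \<noteq> 0 \<and>
           det (mat k k (\<lambda>(i, j). psi i (a j))) \<noteq> 0"
proof (rule ccontr)
  interpret G: comm_group G by fact
  assume contra: "\<not> ?thesis"
  have chi: "chi i \<in> characters G" and psi: "psi i \<in> characters G" if "i < k" for i
    using assms(4-7) that by (auto simp: bij_betw_def)
  have inj: "inj_on chi {0..<k}" "inj_on psi {0..<k}"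
    using assms(6,7) by (auto simp: bij_betw_def)
  \<comment> \<open>The product character, in extensional form so that it belongs to
    \<open>characters G\<close>.\<close>
  define p where "p i j = (\<lambda>a\<in>carrier G. chi i a * psi j a)" for i j
  define T where "T = (\<lambda>(i, j). p i j) ` ({0..<k} \<times> {0..<k})"
  have finT: "finite T" by (simp add: T_def)
  have T: "T \<subseteq> characters G"
    using chi psi by (auto simp: T_def p_def intro!: characters_product G.is_monoid)
  have pT: "p i j \<in> T" if "i < k" "j < k" for i j using that by (auto simp: T_def)
  obtain r :: "('a \<Rightarrow> 'f) \<Rightarrow> nat" where r: "inj_on r T"
    using finite_imp_inj_to_nat_seg[OF finT] by auto
  define c where "c i j = r (p i j)" for i j
  have row: "\<forall>i<k. inj_on (c i) {0..<k}"
  proof (intro allI impI inj_onI)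
    fix i j j' assume i: "i < k" and j: "j \<in> {0..<k}" "j' \<in> {0..<k}" and "c i j = c i j'"
    then have eq: "p i j = p i j'" using inj_onD[OF r] pT by (auto simp: c_def)
    \<comment> \<open>Cancelling the nonzero value \<open>chi i a\<close> recovers the second factor
      from the product.\<close>
    have "psi j a = psi j' a" if "a \<in> carrier G" for a
      using characters_nonzero[OF chi[OF i] that] fun_cong[OF eq, of a] that
      by (simp add: p_def)
    then have "psi j = psi j'" using psi j by (intro characters_eqI) auto
    then show "j = j'" using inj_onD[OF inj(2)] j by simp
  qed
  have col: "\<forall>j<k. inj_on (\<lambda>i. c i j) {0..<k}"
  proof (intro allI impI inj_onI)
    fix j i i' assume j: "j < k" and i: "i \<in> {0..<k}" "i' \<in> {0..<k}" and "c i j = c i' j"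
    then have eq: "p i j = p i' j" using inj_onD[OF r] pT by (auto simp: c_def)
    have "chi i a = chi i' a" if "a \<in> carrier G" for a
      using characters_nonzero[OF psi[OF j] that] fun_cong[OF eq, of a] that
      by (simp add: p_def)
    then have "chi i = chi i'" using chi i by (intro characters_eqI) auto
    then show "i = i'" using inj_onD[OF inj(1)] i by simp
  qed
  obtain w where w: "\<And>\<chi>. \<chi> \<in> T \<Longrightarrow> (\<Sum>a\<in>carrier G. w a * [:\<chi> a:]) = monom 1 (2 ^ r \<chi>)"
    using characters_interpolation[OF G.is_group assms(2) finT T, of "\<lambda>\<chi>. monom 1 (2 ^ r \<chi>)"]
    by blast
  \<comment> \<open>By the assumption, every choice of \<open>k\<close> group elements makes one of
    the two minors zero, over the field and hence also over its polynomial ring.\<close>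
  have "det (mat k k (\<lambda>(i, j). \<Sum>a\<in>carrier G. w a * [:chi i a:] * [:psi j a:])) = 0"
  proof (rule det_sum_product_eq_0[OF assms(2)])
    fix f assume "f \<in> {0..<k} \<rightarrow> carrier G"
    then have "\<forall>j<k. f j \<in> carrier G" by auto
    with contra have "det (mat k k (\<lambda>(i, j). chi i (f j))) = 0 \<or> det (mat k k (\<lambda>(i, j). psi i (f j))) = 0"
      by blast
    then show "det (mat k k (\<lambda>(i, j). [:chi i (f j):])) = 0 \<or> det (mat k k (\<lambda>(i, j). [:psi i (f j):])) = 0"
      using det_const_poly_eq_0[of k "\<lambda>i j. chi i (f j)"] det_const_poly_eq_0[of k "\<lambda>i j. psi i (f j)"]
      by blast
  qed
  \<comment> \<open>Each entry depends only on the product character \<open>p i j\<close>, at which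
    \<open>w\<close> was chosen to yield the monomial with exponent
    \<open>2 ^ c i j\<close>.\<close>
  also have "mat k k (\<lambda>(i, j). \<Sum>a\<in>carrier G. w a * [:chi i a:] * [:psi j a:])
      = mat k k (\<lambda>(i, j). monom 1 (2 ^ c i j))"
  proof (rule eq_matI)
    fix i j assume "i < dim_row (mat k k (\<lambda>(i, j). monom (1::'f) (2 ^ c i j)))"
      "j < dim_col (mat k k (\<lambda>(i, j). monom (1::'f) (2 ^ c i j)))"
    then have ij: "i < k" "j < k" by auto
    have "(\<Sum>a\<in>carrier G. w a * [:chi i a:] * [:psi j a:]) = (\<Sum>a\<in>carrier G. w a * [:p i j a:])"
      by (rule sum.cong) (auto simp: p_def mult_ac)
    with w[OF pT[OF ij]] ij
    show "mat k k (\<lambda>(i, j). \<Sum>a\<in>carrier G. w a * [:chi i a:] * [:psi j a:]) $$ (i, j)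
        = mat k k (\<lambda>(i, j). monom 1 (2 ^ c i j)) $$ (i, j)"
      by (simp add: c_def)
  qed auto
  finally show False
    using det_distinct_monomials_nonzero[OF row col] by blast
qed

end
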